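(* Let $k \ge 3$ and $r$ be positive integers, and let $p = p(n) \in (0,1]$ satisfy $p \geq k \left(\frac{\log n}{n^{k-1}}\right)^{1/k}$. Then asymptotically almost surely $\gamma^{t}_{(k,r)}(G(n,p)) = r+1$; that is, $\mathbb{P}\left[\gamma^{t}_{(k,r)}(G(n,p)) = r+1\right] \to 1$ as $n \to \infty$.
   Context: $G(n,p)$ is the random graph on $n$ vertices in which each of the $\binom{n}{2}$ possible edges is included independently with probability $p$; $\log$ denotes the natural logarithm. For a graph $G$ and vertices $u,v$, $d(u,v)$ denotes the length of a shortest path between $u$ and $v$, and $N_k(v) = \{u \in V(G) : u \neq v,\ d(u,v) \le k\}$. A set $S \subseteq V(G)$ is a total $(k,r)$-dominating set of $G$ if for every vertex $u \in V(G)$, $|N_k(u) \cap S| \ge r$. The total $(k,r)$-domination number $\gamma^{t}_{(k,r)}(G)$ is the minimum cardinality of a total $(k,r)$-dominating set of $G$. *)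

theory Defs
  imports "HOL-Probability.Probability" "HOL-Library.Extended_Nat"
begin

text \<open>A simple graph is a pair \<open>(V, E)\<close>, where \<open>E\<close> is a set of two-element subsets of \<open>V\<close>.\<close>

type_synonym 'a graph = "'a set \<times> 'a set set"

abbreviation verts :: "'a graph \<Rightarrow> 'a set" where
  "verts G \<equiv> fst G"

abbreviation edges :: "'a graph \<Rightarrow> 'a set set" where
  "edges G \<equiv> snd G"

definition possible_edges :: "'a set \<Rightarrow> 'a set set" where
  "possible_edges V = {e. e \<subseteq> V \<and> card e = 2}"

definition gnp :: "nat \<Rightarrow> real \<Rightarrow> nat graph pmf" where
  "gnp n p =
     map_pmf (\<lambda>f. ({..<n}, {e \<in> possible_edges {..<n}. f e}))
       (Pi_pmf (possible_edges {..<n}) False (\<lambda>_. bernoulli_pmf p))"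

definition is_path :: "'a graph \<Rightarrow> 'a \<Rightarrow> 'a list \<Rightarrow> 'a \<Rightarrow> bool" where
  "is_path G u xs v \<longleftrightarrow>
     xs \<noteq> [] \<and> hd xs = u \<and> last xs = v \<and> set xs \<subseteq> verts G \<and> distinct xs \<and>
     successively (\<lambda>x y. {x, y} \<in> edges G) xs"

text \<open>A path through the vertices \<open>xs\<close> has \<open>length xs - 1\<close> edges.  The infimum of the empty set
  is \<open>\<infinity>\<close>, so vertices in different components are at distance \<open>\<infinity>\<close>.\<close>

definition graph_dist :: "'a graph \<Rightarrow> 'a \<Rightarrow> 'a \<Rightarrow> enat" where
  "graph_dist G u v = (INF xs \<in> {xs. is_path G u xs v}. enat (length xs - 1))"

definition nbhd :: "'a graph \<Rightarrow> nat \<Rightarrow> 'a \<Rightarrow> 'a set" where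
  "nbhd G k v = {u \<in> verts G. u \<noteq> v \<and> graph_dist G u v \<le> enat k}"

definition total_dominating :: "nat \<Rightarrow> nat \<Rightarrow> 'a graph \<Rightarrow> 'a set \<Rightarrow> bool" where
  "total_dominating k r G S \<longleftrightarrow>
     S \<subseteq> verts G \<and> (\<forall>u \<in> verts G. card (nbhd G k u \<inter> S) \<ge> r)"

text \<open>The value is \<open>\<infinity>\<close> if the (finite) graph \<open>G\<close> has no total \<open>(k, r)\<close>-dominating set.\<close>

definition total_domination_number :: "nat \<Rightarrow> nat \<Rightarrow> 'a graph \<Rightarrow> enat" where
  "total_domination_number k r G = (INF S \<in> {S. total_dominating k r G S}. enat (card S))"

end

theory Submission
  imports Defs "HOL-Real_Asymp.Real_Asymp"
begin

text \<open>
  A total dominating set contains some vertex, which does not count itself, so it has at least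
  \<open>r + 1\<close> elements. Conversely, \<open>r + 1\<close> fixed vertices suffice if every vertex is within
  distance \<open>k\<close> of each of them, so by a union bound over \<open>(r + 1) n\<close> pairs it is enough that
  two given vertices are at distance more than \<open>k\<close> with probability \<open>o(1 / n)\<close>. By monotonicity
  \<open>p\<close> may be taken at the threshold. Split the other vertices into \<open>k - 1\<close> layers of size
  \<open>m \<approx> n / (k - 1)\<close> and explore from \<open>u\<close> layer by layer. By Chernoff's bound the explored set
  grows by a factor of at least \<open>(1 - \<epsilon>)\<^sup>2 m p\<close> in every step, except with probability
  \<open>exp (- \<Omega>(m p))\<close>; since \<open>m p\<close> is of order at least \<open>n\<^bsup>1/k\<^esup>\<close>, this is
  negligible. The last layer reached then has about \<open>(m p)\<^bsup>k - 1\<^esup>\<close> vertices, none of which is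
  adjacent to \<open>v\<close> with probability about \<open>exp (- p (m p)\<^bsup>k - 1\<^esup>)\<close>, and
  \<open>p (m p)\<^bsup>k - 1\<^esup> \<ge> (1 - o(1)) k log n\<close>, which exceeds \<open>2 log n\<close>.
\<close>

subsection \<open>Products of finite distributions\<close>

text \<open>Stands in for measurability with respect to the coordinates in \<open>D\<close>: under a
  product distribution, functions of complementary sets of coordinates are independent.\<close>

definition depends_only_on :: "'a set \<Rightarrow> (('a \<Rightarrow> 'b) \<Rightarrow> 'c) \<Rightarrow> bool" where
  "depends_only_on D F \<longleftrightarrow> (\<forall>f g. (\<forall>x\<in>D. f x = g x) \<longrightarrow> F f = F g)"

lemma depends_only_onI:
  "(\<And>f g. (\<And>x. x \<in> D \<Longrightarrow> f x = g x) \<Longrightarrow> F f = F g) \<Longrightarrow> depends_only_on D F"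
  unfolding depends_only_on_def by blast

lemma depends_only_onD:
  "depends_only_on D F \<Longrightarrow> (\<And>x. x \<in> D \<Longrightarrow> f x = g x) \<Longrightarrow> F f = F g"
  unfolding depends_only_on_def by blast

lemma depends_only_on_compose: "depends_only_on D F \<Longrightarrow> depends_only_on D (\<lambda>f. h (F f))"
  unfolding depends_only_on_def by metis

lemma finite_set_Pi_pmf:
  fixes q :: "'a \<Rightarrow> 'b::finite pmf"
  assumes "finite C"
  shows "finite (set_pmf (Pi_pmf C d q))"
  using assms by (auto simp: set_Pi_pmf)

text \<open>A sample on \<open>C\<close> arises by merging independent samples on
  \<open>C \<inter> D\<close> and \<open>C - D\<close>; \<open>F\<close> sees only the first and
  \<open>G\<close> only the second. The supports are finite, so the expectation is a finite double
  sum that factors.\<close>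

lemma expectation_Pi_pmf_times_split:
  fixes q :: "'a \<Rightarrow> 'b::finite pmf" and F G :: "('a \<Rightarrow> 'b) \<Rightarrow> real"
  assumes C: "finite C" and F: "depends_only_on D F" and G: "depends_only_on (- D) G"
  shows "measure_pmf.expectation (Pi_pmf C d q) (\<lambda>f. F f * G f) =
    measure_pmf.expectation (Pi_pmf (C \<inter> D) d q) F * measure_pmf.expectation (Pi_pmf (C - D) d q) G"
proof -
  let ?A = "Pi_pmf (C \<inter> D) d q" and ?B = "Pi_pmf (C - D) d q"
  let ?mg = "\<lambda>a b x. if x \<in> C \<inter> D then a x else b x"
  have fA: "finite (set_pmf ?A)" and fB: "finite (set_pmf ?B)"
    using C by (auto intro!: finite_set_Pi_pmf)
  have split: "Pi_pmf C d q = map_pmf (\<lambda>(a, b). ?mg a b) (pair_pmf ?A ?B)"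
    using Pi_pmf_union[of "C \<inter> D" "C - D" d q] C by (simp add: Int_Diff_Un Int_Diff_disjoint)
  have merge: "F (?mg a b) = F a" "G (?mg a b) = G b" if "a \<in> set_pmf ?A" "b \<in> set_pmf ?B" for a b
  proof -
    \<comment> \<open>\<open>D\<close> may contain points outside \<open>C\<close>; there both
      samples take the default value, so \<open>F\<close> does not notice the merge.\<close>
    have a: "a x = d" if "x \<notin> C" for x
      using set_Pi_pmf_subset[of "C \<inter> D" d q] C that \<open>a \<in> _\<close> by auto
    have b: "b x = d" if "x \<notin> C" for x
      using set_Pi_pmf_subset[of "C - D" d q] C that \<open>b \<in> _\<close> by auto
    show "F (?mg a b) = F a"
      by (rule depends_only_onD[OF F]) (use a b in auto)
    show "G (?mg a b) = G b"
      by (rule depends_only_onD[OF G]) auto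
  qed
  have "measure_pmf.expectation (Pi_pmf C d q) (\<lambda>f. F f * G f) =
      measure_pmf.expectation (pair_pmf ?A ?B) (\<lambda>(a, b). F (?mg a b) * G (?mg a b))"
    by (simp add: split case_prod_unfold)
  also have "\<dots> = (\<Sum>(a, b)\<in>set_pmf ?A \<times> set_pmf ?B.
      pmf (pair_pmf ?A ?B) (a, b) * (F (?mg a b) * G (?mg a b)))"
    by (subst integral_measure_pmf[where A = "set_pmf ?A \<times> set_pmf ?B"])
      (use fA fB in \<open>auto simp: case_prod_unfold\<close>)
  also have "\<dots> = (\<Sum>(a, b)\<in>set_pmf ?A \<times> set_pmf ?B. (pmf ?A a * F a) * (pmf ?B b * G b))"
    by (intro sum.cong refl) (auto simp only: case_prod_conv pmf_pair merge mem_Sigma_iff mult_ac split: prod.splits)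
  also have "\<dots> = (\<Sum>a\<in>set_pmf ?A. pmf ?A a * F a) * (\<Sum>b\<in>set_pmf ?B. pmf ?B b * G b)"
    by (simp add: sum_product sum.cartesian_product)
  also have "\<dots> = measure_pmf.expectation ?A F * measure_pmf.expectation ?B G"
    by (subst (1 2) integral_measure_pmf_real[where A = "set_pmf _"])
      (use fA fB in \<open>auto simp: mult.commute\<close>)
  finally show ?thesis .
qed

text \<open>Putting the constant 1 for \<open>G\<close> or for \<open>F\<close> in the split formula
  identifies the expectations over the partial products with those over all of
  \<open>C\<close>.\<close>

lemma expectation_Pi_pmf_times:
  fixes q :: "'a \<Rightarrow> 'b::finite pmf" and F G :: "('a \<Rightarrow> 'b) \<Rightarrow> real"
  assumes C: "finite C" and F: "depends_only_on D F" and G: "depends_only_on (- D) G"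
  shows "measure_pmf.expectation (Pi_pmf C d q) (\<lambda>f. F f * G f) =
    measure_pmf.expectation (Pi_pmf C d q) F * measure_pmf.expectation (Pi_pmf C d q) G"
proof -
  have one: "depends_only_on X (\<lambda>_. 1::real)" for X :: "'a set"
    by (rule depends_only_onI) simp
  show ?thesis
    using expectation_Pi_pmf_times_split[OF C F one, of d q]
      expectation_Pi_pmf_times_split[OF C one G, of d q]
      expectation_Pi_pmf_times_split[OF C F G, of d q]
    by simp
qed

lemma prob_Pi_pmf_conj:
  fixes q :: "'a \<Rightarrow> 'b::finite pmf"
  assumes C: "finite C" and P: "depends_only_on D P" and Q: "depends_only_on (- D) Q"
  shows "measure_pmf.prob (Pi_pmf C d q) {f. P f \<and> Q f} =
    measure_pmf.prob (Pi_pmf C d q) {f. P f} * measure_pmf.prob (Pi_pmf C d q) {f. Q f}"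
proof -
  have "measure_pmf.expectation (Pi_pmf C d q) (\<lambda>f. (of_bool (P f) :: real) * of_bool (Q f)) =
      measure_pmf.expectation (Pi_pmf C d q) (\<lambda>f. of_bool (P f)) *
      measure_pmf.expectation (Pi_pmf C d q) (\<lambda>f. of_bool (Q f))"
    by (rule expectation_Pi_pmf_times[OF C depends_only_on_compose[OF P] depends_only_on_compose[OF Q]])
  moreover have "measure_pmf.expectation M (\<lambda>f. of_bool (R f)) = measure_pmf.prob M {f. R f}"
    for R and M :: "('a \<Rightarrow> 'b) pmf"
  proof -
    have "(\<lambda>f. of_bool (R f) :: real) = indicator {f. R f}"
      by (auto simp: indicator_def fun_eq_iff)
    thus ?thesis by simp
  qed
  ultimately show ?thesis
    by (simp flip: of_bool_conj)
qed

lemma prob_Pi_bernoulli_mono: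
  assumes C: "finite C" and p: "0 \<le> p" "p \<le> p'" "p' \<le> 1"
    and mono: "\<And>f g. P f \<Longrightarrow> (\<And>x. f x \<Longrightarrow> g x) \<Longrightarrow> P g"
  shows "measure_pmf.prob (Pi_pmf C False (\<lambda>_. bernoulli_pmf p)) {f. P f} \<le>
    measure_pmf.prob (Pi_pmf C False (\<lambda>_. bernoulli_pmf p')) {f. P f}"
proof (cases "p' = 0")
  case True
  with p show ?thesis by simp
next
  case False
  \<comment> \<open>Keep each element chosen with probability \<open>p'\<close> independently with probability \<open>p / p'\<close>.\<close>
  let ?Q = "pair_pmf (bernoulli_pmf p') (bernoulli_pmf (p / p'))"
  let ?M = "Pi_pmf C (False, False) (\<lambda>_. ?Q)"
  from False p have p': "0 < p'" "p / p' \<le> 1" "0 \<le> p / p'" by auto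
  have "map_pmf (\<lambda>(a, b). a \<and> b) ?Q = bernoulli_pmf p"
  proof (rule pmf_eqI)
    fix b
    have "pmf (map_pmf (\<lambda>(a, b). a \<and> b) ?Q) True = pmf ?Q (True, True)"
      unfolding pmf_map by (simp add: vimage_def case_prod_unfold prod_eq_iff[symmetric]
        measure_pmf_single[symmetric] cong: conj_cong)
        (rule arg_cong[where f = "measure_pmf.prob ?Q"], auto)
    also have "\<dots> = p"
      using p p' by (simp add: pmf_pair)
    finally have T: "pmf (map_pmf (\<lambda>(a, b). a \<and> b) ?Q) True = p" .
    show "pmf (map_pmf (\<lambda>(a, b). a \<and> b) ?Q) b = pmf (bernoulli_pmf p) b"
    proof (cases b)
      case True
      then show ?thesis using T p by simp
    next
      case False
      then show ?thesis using T p by (simp add: pmf_False_conv_True)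
    qed
  qed
  hence p_eq: "Pi_pmf C False (\<lambda>_. bernoulli_pmf p) = map_pmf (\<lambda>h. (\<lambda>(a, b). a \<and> b) \<circ> h) ?M"
    using Pi_pmf_map[OF C, of "\<lambda>(a, b). a \<and> b" "(False, False)" False "\<lambda>_. ?Q"] by simp
  have p'_eq: "Pi_pmf C False (\<lambda>_. bernoulli_pmf p') = map_pmf (\<lambda>h. fst \<circ> h) ?M"
    using Pi_pmf_map[OF C, of fst "(False, False)" False "\<lambda>_. ?Q"] by (simp add: map_fst_pair_pmf)
  show ?thesis
    unfolding p_eq p'_eq measure_map_pmf
  proof (rule measure_pmf.finite_measure_mono)
    have "P (fst \<circ> h)" if "P ((\<lambda>(a, b). a \<and> b) \<circ> h)" for h :: "'a \<Rightarrow> bool \<times> bool"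
      by (rule mono[OF that]) (auto simp: case_prod_unfold)
    thus "(\<lambda>h. (\<lambda>(a, b). a \<and> b) \<circ> h) -` {f. P f} \<subseteq> (\<lambda>h. fst \<circ> h) -` {f. P f}"
      by blast
  qed simp
qed

subsection \<open>Layered exploration\<close>

text \<open>The random object is the edge indicator, not the graph, so that independence of disjoint
  sets of pairs applies directly; \<open>gnp n p\<close> is its image when \<open>X\<close> is
  \<open>{..<n}\<close>.\<close>

definition edge_pmf :: "'a set \<Rightarrow> real \<Rightarrow> ('a set \<Rightarrow> bool) pmf" where
  "edge_pmf X p = Pi_pmf (possible_edges X) False (\<lambda>_. bernoulli_pmf p)"

lemma finite_possible_edges: "finite X \<Longrightarrow> finite (possible_edges X)"
  by (rule finite_subset[of _ "Pow X"]) (auto simp: possible_edges_def)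

lemma finite_set_edge_pmf: "finite X \<Longrightarrow> finite (set_pmf (edge_pmf X p))"
  unfolding edge_pmf_def by (intro finite_set_Pi_pmf finite_possible_edges)

definition neighbours_in :: "('a set \<Rightarrow> bool) \<Rightarrow> 'a set \<Rightarrow> 'a set \<Rightarrow> 'a set" where
  "neighbours_in f A V = {y \<in> V. \<exists>x\<in>A. f {x, y}}"

text \<open>Only the current frontier is kept, and a round queries only pairs between it and the
  next layer. With disjoint layers no pair is queried twice, so later rounds are independent of how
  a given frontier was reached.\<close>

fun reach :: "('a set \<Rightarrow> bool) \<Rightarrow> 'a set \<Rightarrow> 'a set list \<Rightarrow> 'a set" where
  "reach f A [] = A"
| "reach f A (V # Vs) = reach f (neighbours_in f A V) Vs"

lemma neighbours_in_subset: "neighbours_in f A V \<subseteq> V"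
  by (auto simp: neighbours_in_def)

lemma neighbours_in_cong:
  "(\<And>x y. x \<in> A \<Longrightarrow> y \<in> V \<Longrightarrow> f {x, y} = g {x, y}) \<Longrightarrow> neighbours_in f A V = neighbours_in g A V"
  by (auto simp: neighbours_in_def)

lemma depends_only_on_reach:
  assumes "A \<subseteq> Y" and "\<Union> (set Vs) \<subseteq> Y"
  shows "depends_only_on {e. e \<subseteq> Y} (\<lambda>f. reach f A Vs)"
proof (rule depends_only_onI)
  fix f g :: "'a set \<Rightarrow> bool"
  assume *: "\<And>e. e \<in> {e. e \<subseteq> Y} \<Longrightarrow> f e = g e"
  show "reach f A Vs = reach g A Vs"
    using assms
  proof (induction Vs arbitrary: A)
    case (Cons V Vs)
    have "neighbours_in f A V = neighbours_in g A V"
      by (rule neighbours_in_cong, rule *) (use Cons.prems in auto)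
    moreover have "reach f (neighbours_in g A V) Vs = reach g (neighbours_in g A V) Vs"
      by (rule Cons.IH) (use Cons.prems neighbours_in_subset[of g A V] in auto)
    ultimately show ?case by simp
  qed simp
qed

lemma sorted_wrt_disjnt_subset:
  "sorted_wrt disjnt (V # Vs) \<Longrightarrow> N \<subseteq> V \<Longrightarrow> sorted_wrt disjnt (N # Vs)"
  by (auto intro: disjnt_subset1)

text \<open>Tracing predecessors back from \<open>y\<close> gives one vertex per layer; disjointness
  of the layers makes these distinct, so the walk is a path.\<close>

lemma reach_imp_walk:
  assumes "y \<in> reach f A Vs" and "sorted_wrt disjnt (A # Vs)"
  shows "\<exists>xs. xs \<noteq> [] \<and> hd xs \<in> A \<and> last xs = y \<and> length xs = Suc (length Vs) \<and> distinct xs \<and>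
    set xs \<subseteq> A \<union> \<Union> (set Vs) \<and> successively (\<lambda>u v. f {u, v}) xs"
  using assms
proof (induction Vs arbitrary: A)
  case Nil
  then show ?case by (intro exI[of _ "[y]"]) auto
next
  case (Cons V Vs)
  let ?N = "neighbours_in f A V"
  have "sorted_wrt disjnt (?N # Vs)"
    using Cons.prems(2) by (intro sorted_wrt_disjnt_subset[OF _ neighbours_in_subset]) auto
  with Cons.IH[of ?N] Cons.prems(1) obtain xs where xs: "xs \<noteq> []" "hd xs \<in> ?N" "last xs = y"
    "length xs = Suc (length Vs)" "distinct xs" "set xs \<subseteq> ?N \<union> \<Union> (set Vs)"
    "successively (\<lambda>u v. f {u, v}) xs"
    by auto
  from xs(2) obtain x where x: "x \<in> A" "f {x, hd xs}"
    by (auto simp: neighbours_in_def)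
  have "x \<notin> set xs"
    using x(1) xs(6) Cons.prems(2) neighbours_in_subset[of f A V]
    by (fastforce simp: disjnt_iff)
  with x xs show ?case
    using neighbours_in_subset[of f A V]
    by (intro exI[of _ "x # xs"]) (auto simp: successively_Cons)
qed

section \<open>Neighbours of a fixed set in one layer\<close>

lemma possible_edgesI: "x \<in> X \<Longrightarrow> y \<in> X \<Longrightarrow> x \<noteq> y \<Longrightarrow> {x, y} \<in> possible_edges X"
  by (auto simp: possible_edges_def)

text \<open>Since \<open>v\<close> is not in \<open>A\<close>, the pairs \<open>{x, v}\<close> are
  \<open>card A\<close> different possible edges, and the event is a box fixing these coordinates to
  \<open>False\<close>.\<close>

lemma prob_no_neighbour:
  assumes X: "finite X" and A: "A \<subseteq> X" and v: "v \<in> X" "v \<notin> A" and p: "0 \<le> p" "p \<le> 1"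
  shows "measure_pmf.prob (edge_pmf X p) {f. \<not> (\<exists>x\<in>A. f {x, v})} = (1 - p) ^ card A"
proof -
  let ?E = "(\<lambda>x. {x, v}) ` A"
  have E: "?E \<subseteq> possible_edges X"
    using A v by (auto intro!: possible_edgesI)
  have inj: "inj_on (\<lambda>x. {x, v}) A"
    using v by (auto simp: inj_on_def doubleton_eq_iff)
  let ?B = "\<lambda>e. if e \<in> ?E then {False} else UNIV"
  have "{f. \<not> (\<exists>x\<in>A. f {x, v})} = Pi (possible_edges X) ?B"
    using E by (auto simp: Pi_def split: if_splits)
  hence "measure_pmf.prob (edge_pmf X p) {f. \<not> (\<exists>x\<in>A. f {x, v})} =
      (\<Prod>e\<in>possible_edges X. measure_pmf.prob (bernoulli_pmf p) (?B e))"
    unfolding edge_pmf_def by (simp only: measure_Pi_pmf_Pi[OF finite_possible_edges[OF X]])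
  also have "\<dots> = (\<Prod>e\<in>possible_edges X. if e \<in> ?E then 1 - p else 1)"
    using p by (intro prod.cong) (auto simp: measure_pmf_single)
  also have "\<dots> = (\<Prod>e\<in>?E. 1 - p)"
    using E finite_possible_edges[OF X] by (simp add: prod.If_cases Int_absorb1 del: image_subset_iff)
  also have "\<dots> = (1 - p) ^ card A"
    using inj by (simp add: card_image)
  finally show ?thesis .
qed

text \<open>This is the generating function of a binomial variable with failure probability
  \<open>(1 - p) ^ card A\<close>. Each new vertex \<open>v\<close> of the layer contributes an
  independent factor, because only pairs containing \<open>v\<close> decide whether it is
  reached.\<close>

lemma expectation_power_card_neighbours:
  assumes X: "finite X" and "A \<subseteq> X" "V \<subseteq> X" "disjnt A V" and p: "0 \<le> p" "p \<le> 1"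
  shows "measure_pmf.expectation (edge_pmf X p) (\<lambda>f. z ^ card (neighbours_in f A V)) =
    (z + (1 - z) * (1 - p) ^ card A) ^ card V"
proof -
  have "finite V" using X \<open>V \<subseteq> X\<close> by (rule finite_subset[rotated])
  thus ?thesis
    using \<open>V \<subseteq> X\<close> \<open>disjnt A V\<close>
  proof (induction V rule: finite_induct)
    case empty
    then show ?case by (simp add: neighbours_in_def)
  next
    case (insert v V)
    let ?M = "edge_pmf X p"
    let ?F = "\<lambda>f. if \<exists>x\<in>A. f {x, v} then z else 1"
    let ?G = "\<lambda>f. z ^ card (neighbours_in f A V)"
    have v: "v \<notin> A" "v \<in> X" using insert.prems by (auto simp: disjnt_def)
    have *: "z ^ card (neighbours_in f A (insert v V)) = ?F f * ?G f" for f
    proof -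
      have "neighbours_in f A (insert v V) =
          (if \<exists>x\<in>A. f {x, v} then insert v (neighbours_in f A V) else neighbours_in f A V)"
        by (auto simp: neighbours_in_def)
      moreover have "finite (neighbours_in f A V)" "v \<notin> neighbours_in f A V"
        using insert.hyps neighbours_in_subset[of f A V] by (auto intro: finite_subset)
      ultimately show ?thesis by auto
    qed
    have "measure_pmf.expectation ?M (\<lambda>f. ?F f * ?G f) =
        measure_pmf.expectation ?M ?F * measure_pmf.expectation ?M ?G"
      unfolding edge_pmf_def
    proof (rule expectation_Pi_pmf_times[where D = "{e. v \<in> e}"])
      show "finite (possible_edges X)" using X by (rule finite_possible_edges)
      show "depends_only_on {e. v \<in> e} ?F"
        by (rule depends_only_onI) auto
      show "depends_only_on (- {e. v \<in> e}) ?G"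
      proof (rule depends_only_on_compose, rule depends_only_onI, rule neighbours_in_cong)
        fix f g :: "'a set \<Rightarrow> bool" and x y
        assume fg: "\<And>e. e \<in> - {e. v \<in> e} \<Longrightarrow> f e = g e" and "x \<in> A" "y \<in> V"
        thus "f {x, y} = g {x, y}"
          using v insert.hyps by (intro fg) auto
      qed
    qed
    also have "measure_pmf.expectation ?M ?G = (z + (1 - z) * (1 - p) ^ card A) ^ card V"
      using insert.prems by (intro insert.IH) (auto simp: disjnt_def)
    also have "measure_pmf.expectation ?M ?F = z + (1 - z) * (1 - p) ^ card A"
    proof -
      have "?F = (\<lambda>f. z + (1 - z) * indicator {f. \<not> (\<exists>x\<in>A. f {x, v})} f)"
        by (auto simp: fun_eq_iff indicator_def)
      hence "measure_pmf.expectation ?M ?F =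
          measure_pmf.expectation ?M (\<lambda>f. z + (1 - z) * indicator {f. \<not> (\<exists>x\<in>A. f {x, v})} f)"
        by simp
      also have "\<dots> = z + (1 - z) * measure_pmf.prob ?M {f. \<not> (\<exists>x\<in>A. f {x, v})}"
        by (subst Bochner_Integration.integral_add)
          (auto intro: integrable_measure_pmf_finite[OF finite_set_edge_pmf[OF X]])
      finally show ?thesis
        using prob_no_neighbour[OF X \<open>A \<subseteq> X\<close> v(2,1) p] by simp
    qed
    finally show ?case
      using insert.hyps by (simp add: *)
  qed
qed

text \<open>The difference of the sides vanishes at 0 and has derivative
  \<open>- 1 + x + exp (- x)\<close>, which is nonnegative.\<close>

lemma exp_minus_le_quadratic:
  fixes x :: real
  assumes "0 \<le> x"
  shows "exp (- x) \<le> 1 - x + x\<^sup>2 / 2"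
proof -
  have "(\<lambda>x. 1 - x + x\<^sup>2 / 2 - exp (- x)) 0 \<le> (\<lambda>x::real. 1 - x + x\<^sup>2 / 2 - exp (- x)) x"
  proof (rule DERIV_nonneg_imp_nondecreasing[OF assms])
    fix y :: real
    have "((\<lambda>x::real. 1 - x + x\<^sup>2 / 2 - exp (- x)) has_real_derivative (- 1 + y + exp (- y))) (at y)"
      by (auto intro!: derivative_eq_intros)
    moreover have "0 \<le> - 1 + y + exp (- y)"
      using exp_ge_add_one_self[of "- y"] by simp
    ultimately show "\<exists>d. ((\<lambda>x::real. 1 - x + x\<^sup>2 / 2 - exp (- x)) has_real_derivative d) (at y) \<and> 0 \<le> d"
      by blast
  qed
  thus ?thesis by simp
qed

text \<open>Chernoff's lower-tail bound: Markov's inequality for \<open>exp (- \<epsilon> |N|)\<close>.\<close>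
lemma prob_few_neighbours:
  fixes a b \<epsilon> p :: real
  assumes X: "finite X" and A: "A \<subseteq> X" and V: "V \<subseteq> X" and "disjnt A V"
    and p: "0 \<le> p" "p \<le> 1" and a: "0 \<le> a" "a \<le> card A" and \<epsilon>: "0 \<le> \<epsilon>"
    and b: "b \<le> (1 - \<epsilon>) * (card V * (1 - exp (- p * a)))"
  shows "measure_pmf.prob (edge_pmf X p) {f. real (card (neighbours_in f A V)) < b} \<le>
    exp (- (\<epsilon>\<^sup>2 / 2 * (card V * (1 - exp (- p * a)))))"
proof -
  let ?M = "edge_pmf X p" and ?Z = "\<lambda>f. card (neighbours_in f A V)"
  \<comment> \<open>A vertex of \<open>V\<close> is missed with probability at most
    \<open>exp (- p * a)\<close>, so \<open>\<mu>\<close> bounds the mean from below.\<close>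
  define \<mu> where "\<mu> = card V * (1 - exp (- p * a))"
  define z where "z = exp (- \<epsilon>)"
  have z: "0 < z" "z \<le> 1" using \<epsilon> by (auto simp: z_def)
  have \<mu>: "0 \<le> \<mu>" using p a by (auto simp: \<mu>_def)
  have int: "integrable ?M (\<lambda>f. z ^ ?Z f)"
    by (rule integrable_measure_pmf_finite[OF finite_set_edge_pmf[OF X]])
  have "measure_pmf.prob ?M {f. real (?Z f) < b} \<le> measure_pmf.prob ?M {f. z ^ ?Z f \<ge> exp (- \<epsilon> * b)}"
  proof (intro measure_pmf.finite_measure_mono, safe)
    fix f assume "real (?Z f) < b"
    hence "- \<epsilon> * b \<le> real (?Z f) * (- \<epsilon>)" using \<epsilon> by (simp add: mult.commute mult_left_mono)
    thus "exp (- \<epsilon> * b) \<le> z ^ ?Z f"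
      unfolding z_def exp_of_nat_mult[symmetric] by simp
  qed simp
  also have "\<dots> \<le> measure_pmf.expectation ?M (\<lambda>f. z ^ ?Z f) / exp (- \<epsilon> * b)"
    using integral_Markov_inequality_measure[of ?M "\<lambda>f. z ^ ?Z f" "{}" "exp (- \<epsilon> * b)"] z int
    by simp
  also have "\<dots> = exp (\<epsilon> * b) * (z + (1 - z) * (1 - p) ^ card A) ^ card V"
    by (subst expectation_power_card_neighbours) (use assms in \<open>auto simp: exp_minus field_simps\<close>)
  also have "\<dots> \<le> exp (\<epsilon> * b) * exp (- ((1 - z) * \<mu>))"
  proof (rule mult_left_mono)
    have "(1 - p) ^ card A \<le> exp (- p) ^ card A"
      using p exp_ge_add_one_self[of "- p"] by (intro power_mono) auto
    also have "\<dots> = exp (- p * card A)"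
      by (simp flip: exp_of_nat_mult add: mult.commute)
    also have "\<dots> \<le> exp (- p * a)"
      using a p by (simp add: mult_left_mono)
    finally have "z + (1 - z) * (1 - p) ^ card A \<le> z + (1 - z) * exp (- p * a)"
      using z by (intro add_left_mono mult_left_mono) auto
    also have "\<dots> = 1 + - ((1 - z) * (1 - exp (- p * a)))"
      by (simp add: algebra_simps)
    also have "\<dots> \<le> exp (- ((1 - z) * (1 - exp (- p * a))))"
      by (rule exp_ge_add_one_self)
    finally have "(z + (1 - z) * (1 - p) ^ card A) ^ card V \<le>
        exp (- ((1 - z) * (1 - exp (- p * a)))) ^ card V"
      using z p by (intro power_mono) auto
    thus "(z + (1 - z) * (1 - p) ^ card A) ^ card V \<le> exp (- ((1 - z) * \<mu>))"
      by (simp flip: exp_of_nat_mult add: \<mu>_def algebra_simps)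
  qed simp
  also have "\<dots> = exp (\<epsilon> * b - (1 - z) * \<mu>)"
    by (simp flip: exp_add)
  also have "\<dots> \<le> exp (- (\<epsilon>\<^sup>2 / 2 * \<mu>))"
  proof -
    \<comment> \<open>The exponent is at most \<open>(\<epsilon> * (1 - \<epsilon>) - (\<epsilon> -
      \<epsilon>\<^sup>2 / 2)) * \<mu>\<close>.\<close>
    have "\<epsilon> * b \<le> \<epsilon> * ((1 - \<epsilon>) * \<mu>)"
      using b \<epsilon> by (intro mult_left_mono) (auto simp: \<mu>_def)
    moreover have "(\<epsilon> - \<epsilon>\<^sup>2 / 2) * \<mu> \<le> (1 - z) * \<mu>"
      using exp_minus_le_quadratic[OF \<epsilon>] \<mu> by (intro mult_right_mono) (auto simp: z_def)
    ultimately show ?thesis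
      by (simp add: algebra_simps power2_eq_square)
  qed
  finally show ?thesis by (simp add: \<mu>_def)
qed

section \<open>Failure probability of the exploration\<close>

text \<open>Here \<open>a j\<close> is the size wanted of the frontier after \<open>j\<close>
  rounds. A round misses it with probability at most \<open>\<delta>\<close>; otherwise one sums
  over the exact new frontier \<open>B\<close>, from which the remaining rounds query fresh pairs.
  Finally \<open>t\<close> needs a neighbour in a frontier of size at least
  \<open>a K\<close>.\<close>

lemma prob_not_reached_le:
  fixes a :: "nat \<Rightarrow> real" and \<delta> \<epsilon> p :: real and m :: nat
  assumes X: "finite X" and p: "0 \<le> p" "p \<le> 1" and \<epsilon>: "0 \<le> \<epsilon>"
    and a: "\<And>j. 0 \<le> a j"
    and step: "\<And>j. j < K \<Longrightarrow> a (Suc j) \<le> (1 - \<epsilon>) * (m * (1 - exp (- p * a j)))"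
    and \<delta>: "\<And>j. j < K \<Longrightarrow> exp (- (\<epsilon>\<^sup>2 / 2 * (m * (1 - exp (- p * a j))))) \<le> \<delta>"
    and "A \<subseteq> X" "t \<in> X" "\<And>V. V \<in> set Vs \<Longrightarrow> V \<subseteq> X \<and> card V = m"
    and "sorted_wrt disjnt (A # Vs @ [{t}])" and "a i \<le> card A" and "i + length Vs = K"
  shows "measure_pmf.prob (edge_pmf X p) {f. t \<notin> reach f A (Vs @ [{t}])} \<le>
    length Vs * \<delta> + exp (- p * a K)"
  using assms(8,10-)
proof (induction Vs arbitrary: A i)
  case Nil
  have "{f. t \<notin> reach f A ([] @ [{t}])} = {f. \<not> (\<exists>x\<in>A. f {x, t})}"
    by (auto simp: neighbours_in_def)
  moreover have "t \<notin> A" using Nil.prems by simp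
  ultimately have "measure_pmf.prob (edge_pmf X p) {f. t \<notin> reach f A ([] @ [{t}])} = (1 - p) ^ card A"
    using prob_no_neighbour[OF X Nil.prems(1) \<open>t \<in> X\<close> _ p] by simp
  also have "\<dots> \<le> exp (- p) ^ card A"
    using p exp_ge_add_one_self[of "- p"] by (intro power_mono) auto
  also have "\<dots> = exp (- p * card A)"
    by (simp flip: exp_of_nat_mult add: mult.commute)
  also have "\<dots> \<le> exp (- p * a K)"
    using Nil.prems p by (simp add: mult_left_mono)
  finally show ?case by simp
next
  case (Cons V Vs)
  let ?M = "edge_pmf X p" and ?P = "measure_pmf.prob (edge_pmf X p)"
  let ?N = "\<lambda>f. neighbours_in f A V"
  let ?Us = "Vs @ [{t}]"
  define \<beta> where "\<beta> = length Vs * \<delta> + exp (- p * a K)"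
  define \<B> where "\<B> = {B. B \<subseteq> V \<and> a (Suc i) \<le> card B}"
  have V: "V \<subseteq> X" "card V = m" and "disjnt A V" and iK: "i < K"
    using Cons.prems by auto
  have "finite V" using V X finite_subset by blast
  hence fin: "finite \<B>" unfolding \<B>_def by auto
  have "0 \<le> exp (- (\<epsilon>\<^sup>2 / 2 * (m * (1 - exp (- p * a i)))))" by simp
  hence "0 \<le> \<delta>" using \<delta>[OF iK] by linarith
  hence \<beta>: "0 \<le> \<beta>" by (simp add: \<beta>_def)
  have few: "?P {f. real (card (?N f)) < a (Suc i)} \<le> \<delta>"
    using prob_few_neighbours[OF X Cons.prems(1) V(1) \<open>disjnt A V\<close> p a Cons.prems(4) \<epsilon>, of "a (Suc i)"]
      step[OF iK] \<delta>[OF iK] V(2) by simp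
  have branch: "?P {f. ?N f = B \<and> t \<notin> reach f B ?Us} \<le> ?P {f. ?N f = B} * \<beta>" if "B \<in> \<B>" for B
  proof -
    have B: "B \<subseteq> V" "a (Suc i) \<le> card B" using that by (auto simp: \<B>_def)
    let ?Y = "V \<union> \<Union> (set ?Us)"
    \<comment> \<open>Pairs queried in this round have an endpoint in \<open>A\<close>, hence do not
      lie inside \<open>?Y\<close>, where all later queries take place.\<close>
    have disj: "A \<inter> ?Y = {}"
      using Cons.prems(3) by (auto simp: disjnt_def)
    have "?P {f. ?N f = B \<and> t \<notin> reach f B ?Us} = ?P {f. ?N f = B} * ?P {f. t \<notin> reach f B ?Us}"
      unfolding edge_pmf_def
    proof (rule prob_Pi_pmf_conj[where D = "- {e. e \<subseteq> ?Y}"])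
      show "finite (possible_edges X)" using X by (rule finite_possible_edges)
      show "depends_only_on (- {e. e \<subseteq> ?Y}) (\<lambda>f. ?N f = B)"
      proof (rule depends_only_on_compose[where h = "\<lambda>N. N = B"], rule depends_only_onI, rule neighbours_in_cong)
        fix f g :: "'a set \<Rightarrow> bool" and x y
        assume fg: "\<And>e. e \<in> - {e. e \<subseteq> ?Y} \<Longrightarrow> f e = g e" and "x \<in> A" "y \<in> V"
        thus "f {x, y} = g {x, y}" using disj by (intro fg) blast
      qed
      have "depends_only_on {e. e \<subseteq> ?Y} (\<lambda>f. reach f B ?Us)"
        using B(1) by (intro depends_only_on_reach) blast+
      thus "depends_only_on (- (- {e. e \<subseteq> ?Y})) (\<lambda>f. t \<notin> reach f B ?Us)"
        by (simp only: double_compl depends_only_on_compose[where h = "\<lambda>N. t \<notin> N"])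
    qed
    also have "?P {f. t \<notin> reach f B ?Us} \<le> \<beta>"
      unfolding \<beta>_def
    proof (rule Cons.IH[of B "Suc i"])
      show "sorted_wrt disjnt (B # Vs @ [{t}])"
        using Cons.prems(3) by (intro sorted_wrt_disjnt_subset[OF _ B(1)]) auto
      show "B \<subseteq> X" using B(1) V(1) by (rule order_trans)
    qed (use B Cons.prems in auto)
    finally show ?thesis by (simp add: mult_left_mono)
  qed
  have "{f. t \<notin> reach f A ((V # Vs) @ [{t}])} \<subseteq> {f. real (card (?N f)) < a (Suc i)} \<union>
      (\<Union>B\<in>\<B>. {f. ?N f = B \<and> t \<notin> reach f B ?Us})"
    using neighbours_in_subset[of _ A V] by (auto simp: \<B>_def not_less)
  hence "?P {f. t \<notin> reach f A ((V # Vs) @ [{t}])} \<le> ?P ({f. real (card (?N f)) < a (Suc i)} \<union>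
      (\<Union>B\<in>\<B>. {f. ?N f = B \<and> t \<notin> reach f B ?Us}))"
    by (intro measure_pmf.finite_measure_mono) auto
  also have "\<dots> \<le> ?P {f. real (card (?N f)) < a (Suc i)} +
      ?P (\<Union>B\<in>\<B>. {f. ?N f = B \<and> t \<notin> reach f B ?Us})"
    by (rule measure_Un_le) auto
  also have "?P (\<Union>B\<in>\<B>. {f. ?N f = B \<and> t \<notin> reach f B ?Us}) \<le>
      (\<Sum>B\<in>\<B>. ?P {f. ?N f = B \<and> t \<notin> reach f B ?Us})"
    using fin by (intro measure_pmf.finite_measure_subadditive_finite) auto
  also have "\<dots> \<le> (\<Sum>B\<in>\<B>. ?P {f. ?N f = B} * \<beta>)"
    by (intro sum_mono branch)
  \<comment> \<open>For distinct \<open>B\<close> the events are disjoint, so their total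
    probability is at most 1 and the number of possible frontiers costs nothing.\<close>
  also have "\<dots> = ?P (\<Union>B\<in>\<B>. {f. ?N f = B}) * \<beta>"
    using fin unfolding sum_distrib_right[symmetric]
    by (subst measure_pmf.finite_measure_finite_Union) (auto simp: disjoint_family_on_def)
  also have "\<dots> \<le> 1 * \<beta>"
    using \<beta> by (intro mult_right_mono) auto
  also have "?P {f. real (card (?N f)) < a (Suc i)} + 1 * \<beta> \<le> \<delta> + \<beta>"
    using few by simp
  finally show ?case by (simp add: \<beta>_def algebra_simps)
qed

section \<open>Short paths between two given vertices\<close>

lemma ex_disjoint_layers:
  assumes "finite X" and "l * m \<le> card X"
  shows "\<exists>Vs. length Vs = l \<and> (\<forall>V\<in>set Vs. V \<subseteq> X \<and> card V = m) \<and> sorted_wrt disjnt Vs"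
  using assms
proof (induction l arbitrary: X)
  case (Suc l)
  then obtain V where V: "V \<subseteq> X" "card V = m" "finite V"
    by (metis obtain_subset_with_card_n le_add1 mult_Suc order_trans)
  hence "l * m \<le> card (X - V)"
    using Suc.prems by (simp add: card_Diff_subset)
  with Suc.IH[of "X - V"] Suc.prems obtain Vs where
    "length Vs = l" "\<forall>U\<in>set Vs. U \<subseteq> X - V \<and> card U = m" "sorted_wrt disjnt Vs"
    by auto
  with V show ?case
    by (intro exI[of _ "V # Vs"]) (auto, auto simp: disjnt_iff)
qed simp

text \<open>Asking for a path instead of a bound on \<open>graph_dist\<close> makes monotonicity in
  \<open>f\<close> immediate. Lists count vertices, so \<open>Suc k\<close> entries mean
  \<open>k\<close> edges.\<close>

definition within_dist :: "'a set \<Rightarrow> nat \<Rightarrow> 'a \<Rightarrow> 'a \<Rightarrow> ('a set \<Rightarrow> bool) \<Rightarrow> bool" where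
  "within_dist X k u v f \<longleftrightarrow>
     (\<exists>xs. is_path (X, {e \<in> possible_edges X. f e}) u xs v \<and> length xs \<le> Suc k)"

lemma within_dist_mono:
  assumes "within_dist X k u v f" and "\<And>e. f e \<Longrightarrow> g e"
  shows "within_dist X k u v g"
  using assms unfolding within_dist_def is_path_def
  by (auto intro: successively_mono)

text \<open>Explore from \<open>{u}\<close> through \<open>l\<close> disjoint layers avoiding both
  endpoints, with \<open>{v}\<close> as the last layer and powers of one growth factor
  \<open>b\<close> as frontier bounds. Success gives a path with \<open>l + 2\<close> vertices,
  hence \<open>Suc l\<close> edges.\<close>

lemma prob_not_within_dist_le:
  fixes b \<delta> \<epsilon> p :: real and l m :: nat
  assumes X: "finite X" and p: "0 \<le> p" "p \<le> 1" and \<epsilon>: "0 \<le> \<epsilon>"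
    and uv: "u \<in> X" "v \<in> X" "u \<noteq> v" and m: "l * m \<le> card X - 2"
    and b: "0 \<le> b"
    and step: "\<And>j. j < l \<Longrightarrow> b ^ Suc j \<le> (1 - \<epsilon>) * (m * (1 - exp (- p * b ^ j)))"
    and \<delta>: "\<And>j. j < l \<Longrightarrow> exp (- (\<epsilon>\<^sup>2 / 2 * (m * (1 - exp (- p * b ^ j))))) \<le> \<delta>"
  shows "measure_pmf.prob (edge_pmf X p) {f. \<not> within_dist X (Suc l) u v f} \<le>
    l * \<delta> + exp (- p * b ^ l)"
proof -
  have "card (X - {u, v}) = card X - 2"
    using X uv by (subst card_Diff_subset) auto
  then obtain Vs where Vs: "length Vs = l" "\<And>V. V \<in> set Vs \<Longrightarrow> V \<subseteq> X - {u, v} \<and> card V = m"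
    "sorted_wrt disjnt Vs"
    using ex_disjoint_layers[of "X - {u, v}" l m] X m by auto
  have disj: "sorted_wrt disjnt ({u} # Vs @ [{v}])"
    using Vs uv by (auto simp: sorted_wrt_append)
  have "within_dist X (Suc l) u v f" if "v \<in> reach f {u} (Vs @ [{v}])" for f
  proof -
    from reach_imp_walk[OF that disj] obtain xs where xs: "xs \<noteq> []" "hd xs = u" "last xs = v"
      "length xs = Suc (Suc l)" "distinct xs" "set xs \<subseteq> {u} \<union> \<Union> (set (Vs @ [{v}]))"
      "successively (\<lambda>u v. f {u, v}) xs"
      using Vs(1) by auto
    have "{u} \<union> \<Union> (set (Vs @ [{v}])) \<subseteq> X"
      using Vs(2) uv by fastforce
    with xs(6) have sub: "set xs \<subseteq> X" by (rule order_trans)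
    have "successively (\<lambda>x y. {x, y} \<in> {e \<in> possible_edges X. f e}) xs"
      using xs(5,7) sub
      by (induction xs rule: induct_list012) (auto intro: possible_edgesI)
    with xs sub show ?thesis
      unfolding within_dist_def is_path_def by auto
  qed
  hence "measure_pmf.prob (edge_pmf X p) {f. \<not> within_dist X (Suc l) u v f} \<le>
      measure_pmf.prob (edge_pmf X p) {f. v \<notin> reach f {u} (Vs @ [{v}])}"
    by (intro measure_pmf.finite_measure_mono) auto
  also have "\<dots> \<le> length Vs * \<delta> + exp (- p * (\<lambda>j. b ^ j) l)"
  proof (rule prob_not_reached_le[where i = 0 and a = "\<lambda>j. b ^ j", OF X p \<epsilon> _ step \<delta>])
    show "{u} \<subseteq> X" "v \<in> X" "sorted_wrt disjnt ({u} # Vs @ [{v}])" "0 + length Vs = l"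
      using uv disj Vs(1) by simp_all
    show "V \<subseteq> X \<and> card V = m" if "V \<in> set Vs" for V
      using Vs(2)[OF that] by blast
  qed (use b in simp_all)
  finally show ?thesis using Vs(1) by simp
qed

subsection \<open>Total domination\<close>

lemma total_dominating_card_ge:
  assumes "total_dominating k r G S" and "finite (verts G)" "verts G \<noteq> {}" "r \<ge> 1"
  shows "Suc r \<le> card S"
proof -
  have S: "S \<subseteq> verts G" and dom: "\<And>u. u \<in> verts G \<Longrightarrow> r \<le> card (nbhd G k u \<inter> S)"
    using assms(1) by (auto simp: total_dominating_def)
  have fin: "finite S" using S assms(2) by (rule finite_subset)
  obtain v where "v \<in> verts G" using assms(3) by blast
  \<comment> \<open>The vertex \<open>v\<close> only shows that \<open>S\<close> is nonempty; the
    count is made at an element of \<open>S\<close>, which is missing from its own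
    neighbourhood.\<close>
  with dom[of v] \<open>r \<ge> 1\<close> have "nbhd G k v \<inter> S \<noteq> {}" by auto
  then obtain u where u: "u \<in> S" by blast
  have "nbhd G k u \<inter> S \<subseteq> S - {u}" by (auto simp: nbhd_def)
  hence "card (nbhd G k u \<inter> S) \<le> card (S - {u})" using fin by (intro card_mono) auto
  with dom[of u] u S fin have "r \<le> card (S - {u})" by fastforce
  moreover have "card S = Suc (card (S - {u}))"
    using fin u by (rule card.remove)
  ultimately show ?thesis by simp
qed

lemma total_domination_number_eq_Suc:
  assumes X: "finite X" and S: "S \<subseteq> X" "card S = Suc r" and r: "r \<ge> 1"
    and near: "\<And>s u. s \<in> S \<Longrightarrow> u \<in> X \<Longrightarrow> s \<noteq> u \<Longrightarrow> within_dist X k s u f"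
  shows "total_domination_number k r (X, {e \<in> possible_edges X. f e}) = enat (Suc r)"
proof -
  let ?G = "(X, {e \<in> possible_edges X. f e})"
  have "total_dominating k r ?G S"
    unfolding total_dominating_def
  proof (intro conjI ballI)
    show "S \<subseteq> verts ?G" using S by simp
  next
    fix u assume u: "u \<in> verts ?G"
    have "S - {u} \<subseteq> nbhd ?G k u \<inter> S"
    proof
      fix s assume s: "s \<in> S - {u}"
      with near[of s u] u obtain xs where xs: "is_path ?G s xs u" "length xs \<le> Suc k"
        by (auto simp: within_dist_def)
      have "graph_dist ?G s u \<le> enat (length xs - 1)"
        unfolding graph_dist_def using xs(1) by (intro INF_lower) simp
      also have "\<dots> \<le> enat k" using xs(2) by simp
      finally show "s \<in> nbhd ?G k u \<inter> S"
        using s S by (auto simp: nbhd_def)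
    qed
    hence "card (S - {u}) \<le> card (nbhd ?G k u \<inter> S)"
      using S X by (intro card_mono) (auto intro: finite_subset)
    moreover have "r \<le> card (S - {u})"
      using S by (cases "u \<in> S") auto
    ultimately show "r \<le> card (nbhd ?G k u \<inter> S)" by simp
  qed
  hence "total_domination_number k r ?G \<le> enat (card S)"
    unfolding total_domination_number_def by (intro INF_lower) simp
  moreover have "enat (Suc r) \<le> total_domination_number k r ?G"
    unfolding total_domination_number_def
  proof (rule INF_greatest)
    fix T assume "T \<in> {S. total_dominating k r ?G S}"
    moreover have "X \<noteq> {}" using S by auto
    ultimately show "enat (Suc r) \<le> enat (card T)"
      using total_dominating_card_ge[of k r ?G T] X r by simp
  qed
  ultimately show ?thesis using S by simp
qed

text \<open>The union bound is carried out at the smaller probability \<open>q\<close>, for the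
  event that every vertex is close to all of \<open>{..r}\<close>. This event is increasing, so it
  is at least as likely at \<open>p\<close>, and it forces the value \<open>r + 1\<close>.\<close>

lemma prob_total_domination_number_ge:
  fixes \<eta> :: real
  assumes "r \<ge> 1" "r < n" and q: "0 \<le> q" "q \<le> p" "p \<le> 1"
    and fail: "\<And>s u. s < n \<Longrightarrow> u < n \<Longrightarrow> s \<noteq> u \<Longrightarrow>
      measure_pmf.prob (edge_pmf {..<n} q) {f. \<not> within_dist {..<n} k s u f} \<le> \<eta>"
    and "0 \<le> \<eta>"
  shows "measure_pmf.prob (gnp n p) {G. total_domination_number k r G = enat (r + 1)} \<ge>
    1 - Suc r * (n * \<eta>)"
proof -
  let ?W = "\<lambda>s u f. s \<noteq> u \<longrightarrow> within_dist {..<n} k s u f"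
  let ?P = "\<lambda>f. \<forall>s\<in>{..r}. \<forall>u\<in>{..<n}. ?W s u f"
  let ?prob = "\<lambda>p. measure_pmf.prob (edge_pmf {..<n} p)"
  have "?prob q {f. \<not> ?P f} \<le> ?prob q (\<Union>s\<in>{..r}. \<Union>u\<in>{..<n}. {f. \<not> ?W s u f})"
    by (intro measure_pmf.finite_measure_mono) auto
  also have "\<dots> \<le> (\<Sum>s\<in>{..r}. ?prob q (\<Union>u\<in>{..<n}. {f. \<not> ?W s u f}))"
    by (intro measure_pmf.finite_measure_subadditive_finite) auto
  also have "\<dots> \<le> (\<Sum>s\<in>{..r}. \<Sum>u\<in>{..<n}. ?prob q {f. \<not> ?W s u f})"
    by (intro sum_mono measure_pmf.finite_measure_subadditive_finite) auto
  also have "\<dots> \<le> (\<Sum>s\<in>{..r}. \<Sum>u\<in>{..<n}. \<eta>)"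
  proof (intro sum_mono)
    fix s u assume "s \<in> {..r}" "u \<in> {..<n}"
    thus "?prob q {f. \<not> ?W s u f} \<le> \<eta>"
      using fail[of s u] \<open>r < n\<close> \<open>0 \<le> \<eta>\<close> by (cases "s = u") auto
  qed
  also have "\<dots> = Suc r * (n * \<eta>)" by simp
  finally have "?prob q {f. \<not> ?P f} \<le> Suc r * (n * \<eta>)" .
  moreover have "?prob q {f. ?P f} = 1 - ?prob q {f. \<not> ?P f}"
    using measure_pmf.prob_compl[of "{f. ?P f}" "edge_pmf {..<n} q"]
    unfolding Collect_neg_eq Compl_eq_Diff_UNIV by simp
  ultimately have "1 - Suc r * (n * \<eta>) \<le> ?prob q {f. ?P f}" by simp
  also have "\<dots> \<le> ?prob p {f. ?P f}"
    unfolding edge_pmf_def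
  proof (rule prob_Pi_bernoulli_mono[OF finite_possible_edges q])
    fix f g assume "?P f" and fg: "\<And>e. f e \<Longrightarrow> g e"
    thus "?P g" using within_dist_mono[of _ k _ _ f g, OF _ fg] by blast
  qed simp
  also have "\<dots> \<le> ?prob p ((\<lambda>f. ({..<n}, {e \<in> possible_edges {..<n}. f e})) -`
      {G. total_domination_number k r G = enat (r + 1)})"
  proof (intro measure_pmf.finite_measure_mono subsetI)
    fix f assume "f \<in> {f. ?P f}"
    thus "f \<in> (\<lambda>f. ({..<n}, {e \<in> possible_edges {..<n}. f e})) -`
        {G. total_domination_number k r G = enat (r + 1)}"
      using total_domination_number_eq_Suc[of "{..<n}" "{..r}" r k f] assms(1,2)
      by (auto simp: subset_eq)
  qed simp
  finally show ?thesis
    by (simp add: gnp_def edge_pmf_def)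
qed

section \<open>Estimates at the threshold probability\<close>

text \<open>The choice of \<open>\<epsilon>\<close> makes
  \<open>(1 - \<epsilon>) ^ (3 * (k - 1))\<close> at least 2/3, so that for \<open>k \<ge> 3\<close>
  at least \<open>2 * ln n\<close> remains of \<open>k * ln n\<close>. The hypotheses
  \<open>n_large\<close>, \<open>w_large\<close> and \<open>w_ln\<close> respectively absorb the
  rounding of the layers, make the growth factor at least 1, and keep \<open>q * b ^ j\<close> small
  in every round before the last edge.\<close>

lemma prob_not_within_dist_threshold:
  fixes k n :: nat and \<epsilon> w q :: real
  assumes k: "3 \<le> k" and \<epsilon>_def: "\<epsilon> = 1 / (9 * real k)"
    and w: "0 < w" "w ^ k = real k ^ k * (n * ln n)" and q: "q = w / n" "q \<le> 1"
    and n_large: "real k + 1 \<le> \<epsilon> * n"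
    and w_large: "real (k - 1) \<le> (1 - \<epsilon>) ^ 3 * w"
    and w_ln: "real k ^ k * ln n \<le> 2 * \<epsilon> * w"
    and uv: "u < n" "v < n" "u \<noteq> v"
  shows "measure_pmf.prob (edge_pmf {..<n} q) {f. \<not> within_dist {..<n} k u v f} \<le>
    (k - 1) * exp (- (\<epsilon>\<^sup>2 / 2 * ((1 - \<epsilon>)\<^sup>2 * w / (k - 1)))) + 1 / real n ^ 2"
proof -
  define l where "l = k - 1"
  have kl: "k = Suc l" "l \<ge> 2" using k by (auto simp: l_def)
  have \<epsilon>: "0 < \<epsilon>" "\<epsilon> < 1" using k by (auto simp: \<epsilon>_def field_simps)
  have n: "0 < n" using uv by simp
  have q0: "0 < q" using w n q by simp
  define m where "m = (n - 2) div l"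
  have m_le: "l * m \<le> n - 2" by (simp add: m_def)
  hence "m \<le> n" using kl mult_le_mono1[of 1 l m] by linarith
  \<comment> \<open>Leaving out \<open>u\<close> and \<open>v\<close> and rounding cost at most
    \<open>l + 2 = k + 1\<close> vertices, hence at most \<open>\<epsilon> * n\<close>.\<close>
  have m_ge: "(1 - \<epsilon>) * n / l \<le> m"
  proof -
    have "n - 2 < l * m + l"
      using kl dividend_less_times_div[of l "n - 2"] by (simp add: m_def)
    hence "real n \<le> l * m + l + 2" by (simp flip: of_nat_mult of_nat_add)
    hence "(1 - \<epsilon>) * n \<le> l * m" using n_large kl by (simp add: algebra_simps)
    thus ?thesis using kl by (simp add: field_simps)
  qed
  have mq: "(1 - \<epsilon>) * w / l \<le> m * q" "m * q \<le> w"
  proof -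
    have "((1 - \<epsilon>) * n / l) * q \<le> m * q" using m_ge q0 by (intro mult_right_mono) auto
    thus "(1 - \<epsilon>) * w / l \<le> m * q" using n by (simp add: q)
    have "m * q \<le> n * q" using \<open>m \<le> n\<close> q0 by (intro mult_right_mono) auto
    thus "m * q \<le> w" using n by (simp add: q)
  qed
  \<comment> \<open>One factor \<open>1 - \<epsilon>\<close> pays for the Chernoff deviation and one
    for linearising \<open>1 - exp (- x)\<close>; the rounding of \<open>m\<close> brings a third in
    \<open>b_ge\<close>.\<close>
  define b where "b = (1 - \<epsilon>)\<^sup>2 * (m * q)"
  have b_ge: "(1 - \<epsilon>) ^ 3 * w / l \<le> b"
    using mult_left_mono[OF mq(1), of "(1 - \<epsilon>)\<^sup>2"] by (simp add: b_def power2_eq_square power3_eq_cube mult_ac)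
  moreover have "1 \<le> (1 - \<epsilon>) ^ 3 * w / l"
    using w_large kl by (simp add: field_simps)
  ultimately have b1: "1 \<le> b" by linarith
  have "(1 - \<epsilon>)\<^sup>2 \<le> 1" using \<epsilon> by (intro power_le_one) auto
  hence "b \<le> 1 * w"
    unfolding b_def using mq(2) q0 by (intro mult_mono) auto
  hence bw: "b \<le> w" by simp
  \<comment> \<open>The largest exponent is \<open>l - 1 = k - 2\<close>, and
    \<open>q * w ^ (k - 2) = w ^ k / (n * w)\<close>.\<close>
  have small: "q * b ^ j \<le> 2 * \<epsilon>" if "j < l" for j
  proof -
    have "q * b ^ j \<le> q * b ^ (l - 1)"
      using that b1 q0 by (intro mult_left_mono power_increasing) auto
    also have "\<dots> \<le> q * w ^ (l - 1)"
      using bw b1 q0 by (intro mult_left_mono power_mono) auto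
    also have "\<dots> = w ^ k / (n * w)"
    proof -
      have "k = Suc (Suc (l - 1))" using kl by simp
      hence "w ^ k = w * (w * w ^ (l - 1))" by (metis power_Suc)
      thus ?thesis using w n by (simp add: q)
    qed
    also have "\<dots> = real k ^ k * ln n / w"
      using n by (simp add: w)
    also have "\<dots> \<le> 2 * \<epsilon>"
      using w_ln w by (simp add: field_simps)
    finally show ?thesis .
  qed
  \<comment> \<open>Combines \<open>x - x\<^sup>2 / 2 \<le> 1 - exp (- x)\<close> with
    \<open>x \<le> 2 * \<epsilon>\<close>.\<close>
  have expand: "(1 - \<epsilon>) * (q * b ^ j) \<le> 1 - exp (- q * b ^ j)" if "j < l" for j
  proof -
    let ?x = "q * b ^ j"
    have x: "0 \<le> ?x" using q0 b1 by auto
    have "?x * ?x \<le> 2 * \<epsilon> * ?x" using small[OF that] x by (intro mult_right_mono) auto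
    thus ?thesis using exp_minus_le_quadratic[OF x] by (simp add: algebra_simps power2_eq_square)
  qed
  have "measure_pmf.prob (edge_pmf {..<n} q) {f. \<not> within_dist {..<n} (Suc l) u v f} \<le>
      l * exp (- (\<epsilon>\<^sup>2 / 2 * ((1 - \<epsilon>)\<^sup>2 * w / l))) + exp (- q * b ^ l)"
  proof (rule prob_not_within_dist_le)
    show "b ^ Suc j \<le> (1 - \<epsilon>) * (m * (1 - exp (- q * b ^ j)))" if "j < l" for j
      using mult_left_mono[OF expand[OF that], of "(1 - \<epsilon>) * m"] \<epsilon>
      by (simp add: b_def power2_eq_square mult_ac)
    \<comment> \<open>As \<open>b\<close> is at least 1, the bound for the first round serves for
      all of them.\<close>
    show "exp (- (\<epsilon>\<^sup>2 / 2 * (m * (1 - exp (- q * b ^ j))))) \<le> exp (- (\<epsilon>\<^sup>2 / 2 * ((1 - \<epsilon>)\<^sup>2 * w / l)))"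
      if "j < l" for j
    proof -
      have "(1 - \<epsilon>)\<^sup>2 * w / l = (1 - \<epsilon>) * ((1 - \<epsilon>) * w / l)"
        by (simp add: power2_eq_square)
      also have "\<dots> \<le> (1 - \<epsilon>) * (m * q)"
        using mq(1) \<epsilon> by (intro mult_left_mono) auto
      also have "\<dots> \<le> (1 - \<epsilon>) * (m * q) * b ^ j"
        using mult_left_mono[OF one_le_power[OF b1, of j], of "(1 - \<epsilon>) * (m * q)"] \<epsilon> q0 by simp
      also have "\<dots> = m * ((1 - \<epsilon>) * (q * b ^ j))" by simp
      also have "\<dots> \<le> m * (1 - exp (- q * b ^ j))"
        using expand[OF that] by (intro mult_left_mono) auto
      finally have "\<epsilon>\<^sup>2 / 2 * ((1 - \<epsilon>)\<^sup>2 * w / l) \<le> \<epsilon>\<^sup>2 / 2 * (m * (1 - exp (- q * b ^ j)))"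
        by (intro mult_left_mono) auto
      thus ?thesis by simp
    qed
  qed (use q0 q \<epsilon> uv m_le b1 in auto)
  also have "exp (- q * b ^ l) \<le> exp (- (2 * ln n))"
  proof -
    have "2 / 3 \<le> 1 + real (3 * l) * (- \<epsilon>)"
      using kl by (simp add: \<epsilon>_def field_simps)
    also have "\<dots> \<le> (1 + (- \<epsilon>)) ^ (3 * l)"
      using \<epsilon> by (intro Bernoulli_inequality) auto
    finally have bern: "2 / 3 \<le> (1 - \<epsilon>) ^ (3 * l)" by simp
    have "ln n \<ge> 0" using n by simp
    have "2 * ln n \<le> 2 / 3 * (k * ln n)"
      using k mult_right_mono[OF _ \<open>ln n \<ge> 0\<close>, of 3 "real k"] by simp
    \<comment> \<open>With \<open>k = l + 1\<close>, the quotient \<open>k ^ k / l ^ l\<close> is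
      \<open>k * (k / l) ^ l\<close>, whose second factor is at least 1.\<close>
    also have "\<dots> \<le> (1 - \<epsilon>) ^ (3 * l) * ((real k / l) ^ l * (k * ln n))"
    proof (rule mult_mono[OF bern])
      have "1 \<le> (real k / l) ^ l" using kl by (intro one_le_power) (simp add: field_simps)
      thus "k * ln n \<le> (real k / l) ^ l * (k * ln n)"
        using mult_right_mono[of 1 "(real k / l) ^ l" "k * ln n"] \<open>ln n \<ge> 0\<close> by simp
    qed (use \<epsilon> \<open>ln n \<ge> 0\<close> in auto)
    also have "\<dots> = (1 - \<epsilon>) ^ (3 * l) * (real k ^ k * ln n) / real l ^ l"
      unfolding kl(1) by (simp add: power_divide field_simps)
    also have "\<dots> = (1 - \<epsilon>) ^ (3 * l) * (w ^ k / n) / real l ^ l"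
      using n by (simp add: w)
    also have "\<dots> = q * ((1 - \<epsilon>) ^ 3 * w / l) ^ l"
      unfolding power_mult[of "1 - \<epsilon>" 3 l] using n by (simp add: kl(1) q power_divide power_mult_distrib)
    also have "\<dots> \<le> q * b ^ l"
      using b_ge q0 \<epsilon> w by (intro mult_left_mono power_mono) auto
    finally show ?thesis by simp
  qed
  also have "exp (- (2 * ln n)) = 1 / real n ^ 2"
    using n by (simp add: exp_minus exp_double divide_inverse power2_eq_square flip: exp_of_nat_mult)
  finally show ?thesis by (simp add: kl(1))
qed

section \<open>Passage to the limit\<close>

theorem theorem11:
  fixes k r :: nat and p :: "nat \<Rightarrow> real"
  assumes "k \<ge> 3" and "r \<ge> 1"
    and "\<And>n. n \<ge> 1 \<Longrightarrow> 0 < p n \<and> p n \<le> 1"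
    and "\<forall>\<^sub>F n in sequentially.
           p n \<ge> real k * (ln (real n) / real n ^ (k - 1)) powr (1 / real k)"
  shows "(\<lambda>n. measure_pmf.prob (gnp n (p n))
                {G. total_domination_number k r G = enat (r + 1)}) \<longlonglongrightarrow> 1"
proof -
  define \<epsilon> where "\<epsilon> = 1 / (9 * real k)"
  \<comment> \<open>Chosen so that \<open>w n / n\<close> is the threshold in the hypothesis on
    \<open>p\<close>; then \<open>\<eta> n\<close> is the failure bound for one pair of vertices,
    with \<open>c * w n\<close> as its exponent.\<close>
  define w where "w = (\<lambda>n. real k * (real n * ln (real n)) powr (1 / real k))"
  define c where "c = \<epsilon>\<^sup>2 / 2 * ((1 - \<epsilon>)\<^sup>2 / real (k - 1))"
  define \<eta> where "\<eta> = (\<lambda>n. real (k - 1) * exp (- (c * w n)) + 1 / real n ^ 2)"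
  define \<theta> where "\<theta> = 1 / real k"
  have k: "0 < k" "0 < real k" "0 < real (k - 1)" using \<open>k \<ge> 3\<close> by auto
  have \<epsilon>: "0 < \<epsilon>" "\<epsilon> < 1" using \<open>k \<ge> 3\<close> by (auto simp: \<epsilon>_def field_simps)
  have c: "0 < c" using \<epsilon> k by (simp add: c_def)
  have \<theta>: "0 < \<theta>" using k by (simp add: \<theta>_def)
  have w_top: "filterlim w at_top sequentially"
    unfolding w_def \<theta>_def[symmetric] using k(2) \<theta> by real_asymp
  \<comment> \<open>This supplies the hypothesis \<open>w_ln\<close> for large
    \<open>n\<close>.\<close>
  have "(\<lambda>n. ln (real n) / w n) \<longlonglongrightarrow> 0"
    unfolding w_def \<theta>_def[symmetric] using k(2) \<theta> by real_asymp
  hence "\<forall>\<^sub>F n in sequentially. ln (real n) / w n < 2 * \<epsilon> / real k ^ k"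
    by (rule order_tendstoD) (use \<epsilon> k in simp)
  moreover have "\<forall>\<^sub>F n in sequentially. 1 + real (k - 1) / (1 - \<epsilon>) ^ 3 \<le> w n"
    using w_top by (auto simp: filterlim_at_top)
  moreover have "\<forall>\<^sub>F n in sequentially. real k + 1 \<le> \<epsilon> * real n"
    using \<epsilon>(1) by real_asymp
  moreover note eventually_gt_at_top[of r] eventually_ge_at_top[of 2] assms(4)
  ultimately have lower: "\<forall>\<^sub>F n in sequentially. 1 - Suc r * (n * \<eta> n) \<le>
      measure_pmf.prob (gnp n (p n)) {G. total_domination_number k r G = enat (r + 1)}"
  proof eventually_elim
    case (elim n)
    have ln: "0 < real n * ln (real n)" using elim by simp
    have w0: "0 < w n" unfolding w_def using ln k elim by (intro mult_pos_pos) auto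
    have "(1 - \<epsilon>) ^ 3 * (real (k - 1) / (1 - \<epsilon>) ^ 3) \<le> (1 - \<epsilon>) ^ 3 * w n"
      using elim \<epsilon> by (intro mult_left_mono) auto
    hence w_large: "real (k - 1) \<le> (1 - \<epsilon>) ^ 3 * w n" using \<epsilon> by simp
    have w_pow: "w n ^ k = real k ^ k * (real n * ln (real n))"
    proof -
      have "(x powr (1 / real k)) ^ k = x" if "0 < x" for x :: real
        using that k by (simp add: powr_power)
      from this[OF ln] show ?thesis by (simp add: w_def power_mult_distrib)
    qed
    \<comment> \<open>Writing \<open>n\<close> as \<open>(n ^ k) powr (1 / k)\<close> moves the
      division under the root.\<close>
    have "w n / n = real k * (ln (real n) / real n ^ (k - 1)) powr (1 / real k)"
    proof -
      have "real n powr k = real n * real n ^ (k - 1)"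
        using elim k by (simp add: powr_realpow power_eq_if)
      hence "ln (real n) / real n ^ (k - 1) = (real n * ln (real n)) / real n powr k"
        using elim by simp
      also have "\<dots> powr (1 / real k) = (real n * ln (real n)) powr (1 / real k) / real n"
        using elim ln k by (simp add: powr_divide powr_powr)
      finally show ?thesis by (simp add: w_def)
    qed
    hence q: "w n / n \<le> p n" using elim by simp
    show ?case
    proof (rule prob_total_domination_number_ge[OF \<open>r \<ge> 1\<close> _ _ q])
      fix s u :: nat assume su: "s < n" "u < n" "s \<noteq> u"
      have "p n \<le> 1" using assms(3)[of n] elim by simp
      with q have "w n / n \<le> 1" by (rule order_trans)
      moreover have "real k ^ k * ln (real n) \<le> 2 * \<epsilon> * w n"
        using elim(1) w0 k by (simp add: field_simps)
      ultimately have "measure_pmf.prob (edge_pmf {..<n} (w n / n)) {f. \<not> within_dist {..<n} k s u f} \<le>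
          (k - 1) * exp (- (\<epsilon>\<^sup>2 / 2 * ((1 - \<epsilon>)\<^sup>2 * w n / (k - 1)))) + 1 / real n ^ 2"
        using prob_not_within_dist_threshold[OF \<open>k \<ge> 3\<close> \<epsilon>_def w0 w_pow refl _ elim(3) w_large _ su]
        by blast
      moreover have "\<epsilon>\<^sup>2 / 2 * ((1 - \<epsilon>)\<^sup>2 * w n / (k - 1)) = c * w n"
        by (simp add: c_def)
      ultimately show "measure_pmf.prob (edge_pmf {..<n} (w n / n)) {f. \<not> within_dist {..<n} k s u f} \<le> \<eta> n"
        by (simp only: \<eta>_def)
    next
      show "r < n" by (rule elim)
      show "0 \<le> w n / n" "0 \<le> \<eta> n" using w0 by (simp_all add: \<eta>_def)
      show "p n \<le> 1" using assms(3)[of n] elim(5) by simp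
    qed
  qed
  have "(\<lambda>n. 1 - Suc r * (n * \<eta> n)) \<longlonglongrightarrow> 1"
  proof -
    \<comment> \<open>\<open>w n\<close> eventually exceeds every multiple of \<open>ln n\<close>,
      so the exponential beats the factor \<open>n\<close> from the union bound.\<close>
    have "(\<lambda>n. real n * exp (- (c * w n))) \<longlonglongrightarrow> 0"
      unfolding w_def \<theta>_def[symmetric] using k(2) \<theta> c by real_asymp
    moreover have "(\<lambda>n. real n * (1 / real n ^ 2)) \<longlonglongrightarrow> 0"
      by real_asymp
    ultimately have "(\<lambda>n. 1 - real (Suc r) * (real (k - 1) * (real n * exp (- (c * w n))) +
        real n * (1 / real n ^ 2))) \<longlonglongrightarrow> 1 - real (Suc r) * (real (k - 1) * 0 + 0)"
      by (intro tendsto_intros)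
    moreover have "real (k - 1) * (real n * exp (- (c * w n))) + real n * (1 / real n ^ 2) = n * \<eta> n" for n
      by (simp add: \<eta>_def algebra_simps)
    ultimately show ?thesis by simp
  qed
  from lower _ this tendsto_const show ?thesis
    by (rule tendsto_sandwich) simp
qed

end
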